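(* Let $D$ be sparse and $d_m<n$. There exists an uncountably infinite family of values $\gamma\in F^+$ which are not translation equivalent to any rational number.
   Context: Let $n\ge 3$ be an integer and let $D=\{d_1<d_2<\cdots<d_m\}\subseteq\{0,1,\ldots,n-1\}$ be a digit set with $2\le m<n$ and $d_1=0$. Put $C=C_{n,D}:=\{\sum_{k=1}^\infty x_k n^{-k} : x_k\in D \text{ for all } k\ge1\}$ and $\Delta:=D-D$. $D$ is sparse if $|\delta-\delta'|\ge 2$ for all $\delta\ne\delta'$ in $\Delta$. $F:=\{t\in\mathbb{R} : C\cap(C+t)\ne\varnothing\}$ and $F^+:=F\cap[0,\infty)$. For $t\in\mathbb{R}$, if $C\cap(C+t)\neq\varnothing$ let $C(t):=(C\cap(C+t))-\inf(C\cap(C+t))$, otherwise $C(t):=\varnothing$. Real numbers $s,t$ are translation equivalent if $C(s)=C(t)$. *)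

theory Defs
  imports Complex_Main "HOL-Library.Countable_Set"
begin

text \<open>Digits are integers, so that differences of digits are not truncated.\<close>

definition digit_cantor_set :: "nat \<Rightarrow> int set \<Rightarrow> real set" where
  "digit_cantor_set n D =
     {(\<Sum>k. of_int (x (Suc k)) / real n ^ Suc k) | x :: nat \<Rightarrow> int. \<forall>k\<ge>1. x k \<in> D}"

definition digit_differences :: "int set \<Rightarrow> int set" where
  "digit_differences D = {a - b | a b. a \<in> D \<and> b \<in> D}"

definition sparse_digits :: "int set \<Rightarrow> bool" where
  "sparse_digits D \<longleftrightarrow>
     (\<forall>\<delta>\<in>digit_differences D. \<forall>\<delta>'\<in>digit_differences D. \<delta> \<noteq> \<delta>' \<longrightarrow> \<bar>\<delta> - \<delta>'\<bar> \<ge> 2)"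

definition self_intersection :: "nat \<Rightarrow> int set \<Rightarrow> real \<Rightarrow> real set" where
  "self_intersection n D t = digit_cantor_set n D \<inter> (\<lambda>x. x + t) ` digit_cantor_set n D"

definition intersecting_translations :: "nat \<Rightarrow> int set \<Rightarrow> real set" where
  "intersecting_translations n D = {t. self_intersection n D t \<noteq> {}}"

definition nonneg_intersecting_translations :: "nat \<Rightarrow> int set \<Rightarrow> real set" where
  "nonneg_intersecting_translations n D = intersecting_translations n D \<inter> {0..}"

definition normalized_intersection :: "nat \<Rightarrow> int set \<Rightarrow> real \<Rightarrow> real set" where
  "normalized_intersection n D t =
     (if self_intersection n D t \<noteq> {}
      then (\<lambda>x. x - Inf (self_intersection n D t)) ` self_intersection n D t
      else {})"

definition translation_equivalent :: "nat \<Rightarrow> int set \<Rightarrow> real \<Rightarrow> real \<Rightarrow> bool" where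
  "translation_equivalent n D s t \<longleftrightarrow>
     normalized_intersection n D s = normalized_intersection n D t"

end

theory Submission
  imports Defs
begin

text \<open>Only countably many sets C(q) come from rational q, so it suffices that C(t) takes
  uncountably many values on nonnegative t. With d = max D, use the translations t(A) whose
  base-n digits are d at the positions in A and 0 elsewhere. Since t(A) lies in C and min C = 0,
  the infimum of the intersection is t(A), so C(t(A)) consists of the y in C with y + t(A) in C.
  Sparsity implies that this set contains d / n^(k+1) exactly when k is not in A, so A can be
  recovered from C(t(A)).\<close>

text \<open>Digits are numbered from 0, so \<open>x k\<close> has weight 1/n^(k+1), and deleting the
  leading digit is the plain shift \<open>\<lambda>k. x (Suc k)\<close>. This suits induction on the
  digit position.\<close>

definition expansion :: "nat \<Rightarrow> (nat \<Rightarrow> int) \<Rightarrow> real" where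
  "expansion n x = (\<Sum>k. of_int (x k) / real n ^ Suc k)"

lemma digit_cantor_set_eq_expansion:
  "digit_cantor_set n D = {expansion n x | x. \<forall>k. x k \<in> D}" (is "?L = ?R")
proof (intro equalityI subsetI)
  fix v assume "v \<in> ?L"
  then obtain x where "v = expansion n (\<lambda>k. x (Suc k))" "\<forall>k\<ge>1. x k \<in> D"
    unfolding digit_cantor_set_def expansion_def by blast
  then show "v \<in> ?R" by auto
next
  fix v assume "v \<in> ?R"
  then obtain x where x: "v = expansion n x" "\<forall>k. x k \<in> D" by blast
  \<comment> \<open>The digits move up by one place. Truncated subtraction gives index 0 a junk
    value, which the sum never reads.\<close>
  have "v = (\<Sum>k. of_int ((\<lambda>j. x (j - 1)) (Suc k)) / real n ^ Suc k)"
    by (simp add: x(1) expansion_def)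
  with x(2) show "v \<in> ?L"
    unfolding digit_cantor_set_def by (intro CollectI exI[of _ "\<lambda>j. x (j - 1)"]) auto
qed

text \<open>A geometric series of ratio 1/n. It dominates every expansion with digits in 0..n-1,
  giving both convergence and the upper bound 1.\<close>

lemma digits_at_most_sums_one:
  assumes "n \<ge> 2"
  shows "(\<lambda>k. (real n - 1) / real n ^ Suc k) sums 1"
proof -
  have "(\<lambda>k. (real n - 1) / real n * (1 / real n) ^ k) sums
      ((real n - 1) / real n * (1 / (1 - 1 / real n)))"
    using assms by (intro sums_mult geometric_sums) auto
  moreover have "(real n - 1) / real n * (1 / (1 - 1 / real n)) = 1"
    using assms by (simp add: field_simps)
  moreover have "(\<lambda>k. (real n - 1) / real n * (1 / real n) ^ k)
      = (\<lambda>k. (real n - 1) / real n ^ Suc k)"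
    by (simp add: power_divide)
  ultimately show ?thesis
    by (simp only:)
qed

lemma expansion_summable:
  assumes "n \<ge> 2" and "\<And>k. x k \<in> {0..int n - 1}"
  shows "summable (\<lambda>k. of_int (x k) / real n ^ Suc k :: real)"
proof (rule summable_comparison_test')
  show "summable (\<lambda>k. (real n - 1) / real n ^ Suc k)"
    using digits_at_most_sums_one[OF assms(1)] by (rule sums_summable)
next
  fix k :: nat
  have "0 \<le> real_of_int (x k)" "real_of_int (x k) \<le> real n - 1"
    using assms(2)[of k] by auto
  then show "norm (of_int (x k) / real n ^ Suc k :: real) \<le> (real n - 1) / real n ^ Suc k"
    by (simp add: divide_right_mono)
qed

lemma expansion_nonneg:
  assumes "n \<ge> 2" and "\<And>k. x k \<in> {0..int n - 1}"
  shows "0 \<le> expansion n x"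
  unfolding expansion_def
  using expansion_summable[OF assms] assms(2) by (intro suminf_nonneg) auto

lemma expansion_le_1:
  assumes "n \<ge> 2" and "\<And>k. x k \<in> {0..int n - 1}"
  shows "expansion n x \<le> 1"
proof -
  have "real_of_int (x k) \<le> real n - 1" for k
    using assms(2)[of k] by auto
  then have "expansion n x \<le> (\<Sum>k. (real n - 1) / real n ^ Suc k)"
    unfolding expansion_def
    using expansion_summable[OF assms] digits_at_most_sums_one[OF assms(1)]
    by (intro suminf_le divide_right_mono sums_summable) auto
  also have "\<dots> = 1"
    using digits_at_most_sums_one[OF assms(1)] by (rule sums_unique[symmetric])
  finally show ?thesis .
qed

text \<open>Splitting off the first term and taking 1/n out of the rest. This step lets two
  expansions be compared one leading digit at a time.\<close>

lemma expansion_shift: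
  assumes "n \<ge> 2" and "\<And>k. x k \<in> {0..int n - 1}"
  shows "real n * expansion n x = of_int (x 0) + expansion n (\<lambda>k. x (Suc k))"
proof -
  have "summable (\<lambda>k. of_int (x k) / real n ^ Suc k :: real)"
    using assms by (rule expansion_summable)
  then have "expansion n x
      = of_int (x 0) / real n + (\<Sum>k. of_int (x (Suc k)) / real n ^ Suc (Suc k))"
    unfolding expansion_def by (subst suminf_split_head) auto
  moreover have "(\<Sum>k. of_int (x (Suc k)) / real n ^ Suc (Suc k) :: real)
      = (\<Sum>k. of_int (x (Suc k)) / real n ^ Suc k) / real n"
    using suminf_divide[OF expansion_summable[OF assms(1), of "\<lambda>k. x (Suc k)"], of "real n"] assms(2)
    by (simp add: field_simps)
  ultimately show ?thesis
    using assms(1) by (simp add: expansion_def field_simps)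
qed

text \<open>Position k holds 0, so there is no carry: adding a series with a single nonzero term
  changes only that digit.\<close>

lemma expansion_add_digit:
  assumes "n \<ge> 2" and "\<And>k. x k \<in> {0..int n - 1}" and "x k = 0"
  shows "expansion n (x(k := a)) = expansion n x + of_int a / real n ^ Suc k"
proof -
  have "(\<lambda>j. of_int (x j) / real n ^ Suc j) sums expansion n x"
    unfolding expansion_def using assms by (intro summable_sums expansion_summable)
  moreover have "(\<lambda>j. if j = k then of_int a / real n ^ Suc j else 0) sums
      (of_int a / real n ^ Suc k)"
    by (rule sums_single)
  ultimately have "(\<lambda>j. of_int (x j) / real n ^ Suc j
      + (if j = k then of_int a / real n ^ Suc j else 0)) sums
      (expansion n x + of_int a / real n ^ Suc k)"
    by (rule sums_add)
  moreover have "(\<lambda>j. of_int (x j) / real n ^ Suc j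
      + (if j = k then of_int a / real n ^ Suc j else 0))
      = (\<lambda>j. of_int ((x(k := a)) j) / real n ^ Suc j :: real)"
    using assms(3) by auto
  ultimately show ?thesis
    unfolding expansion_def by (simp add: sums_iff)
qed

text \<open>Sparsity concerns differences of digits; comparing a - b with 0 = a - a turns it into a
  gap between the digits themselves.\<close>

lemma sparse_digits_gap:
  assumes "sparse_digits D" "a \<in> D" "b \<in> D" "a \<noteq> b"
  shows "\<bar>a - b\<bar> \<ge> 2"
proof -
  have "a - b \<in> digit_differences D" "a - a \<in> digit_differences D"
    using assms unfolding digit_differences_def by blast+
  with assms show ?thesis
    unfolding sparse_digits_def by fastforce
qed

text \<open>Adding the maximal digit where t already has it asks for a digit 2d, and carries cannot
  repair this. The induction on k strips leading digits, which sparsity forces to agree, until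
  position k comes first.\<close>

lemma expansion_neq_add_max_digit:
  assumes "n \<ge> 2" and D: "D \<subseteq> {0..d}" and "d \<in> D" "2 \<le> d" "d < int n"
    and sparse: "sparse_digits D"
    and "\<And>j. x j \<in> D" "\<And>j. t j \<in> D" "t k = d"
  shows "expansion n x \<noteq> expansion n t + of_int d / real n ^ Suc k"
  using assms(7-9)
proof (induction k arbitrary: x t)
  case (0 x t)
  have dig: "x j \<in> {0..int n - 1}" "t j \<in> {0..int n - 1}" for j
    using 0(1,2)[of j] D \<open>d < int n\<close> by force+
  show ?case
  proof
    assume "expansion n x = expansion n t + of_int d / real n ^ Suc 0"
    then have "real n * expansion n x = real n * expansion n t + of_int d"
      using \<open>n \<ge> 2\<close> by (simp add: field_simps)
    \<comment> \<open>The term 2d is the digit \<open>t 0 = d\<close> plus the added d.\<close>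
    then have "of_int (x 0) + expansion n (\<lambda>k. x (Suc k))
        = of_int (2 * d) + expansion n (\<lambda>k. t (Suc k))"
      using expansion_shift[OF \<open>n \<ge> 2\<close>, of x] expansion_shift[OF \<open>n \<ge> 2\<close>, of t] dig \<open>t 0 = d\<close>
      by simp
    moreover have "expansion n (\<lambda>k. x (Suc k)) \<le> 1" "0 \<le> expansion n (\<lambda>k. t (Suc k))"
      using \<open>n \<ge> 2\<close> dig by (auto intro!: expansion_le_1 expansion_nonneg simp del: atLeastAtMost_iff)
    \<comment> \<open>Since x 0 is at most d and d is at least 2, the leading digits differ by at
      least 2, while the tail of x makes up at most 1.\<close>
    moreover have "x 0 + 2 \<le> 2 * d"
      using 0(1)[of 0] D \<open>2 \<le> d\<close> by force
    then have "of_int (x 0) + (2::real) \<le> of_int (2 * d)" by linarith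
    ultimately show False by linarith
  qed
next
  case (Suc k x t)
  have dig: "x j \<in> {0..int n - 1}" "t j \<in> {0..int n - 1}" for j
    using Suc.prems(1,2)[of j] D \<open>d < int n\<close> by force+
  show ?case
  proof
    assume "expansion n x = expansion n t + of_int d / real n ^ Suc (Suc k)"
    then have "real n * expansion n x = real n * expansion n t + of_int d / real n ^ Suc k"
      using \<open>n \<ge> 2\<close> by (simp add: field_simps)
    then have eq: "of_int (x 0) + expansion n (\<lambda>k. x (Suc k))
        = of_int (t 0) + expansion n (\<lambda>k. t (Suc k)) + of_int d / real n ^ Suc k"
      using expansion_shift[OF \<open>n \<ge> 2\<close>, of x] expansion_shift[OF \<open>n \<ge> 2\<close>, of t] dig by simp
    have bounds: "0 \<le> expansion n (\<lambda>k. x (Suc k))" "expansion n (\<lambda>k. x (Suc k)) \<le> 1"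
      "0 \<le> expansion n (\<lambda>k. t (Suc k))" "expansion n (\<lambda>k. t (Suc k)) \<le> 1"
      using \<open>n \<ge> 2\<close> dig by (auto intro!: expansion_le_1 expansion_nonneg simp del: atLeastAtMost_iff)
    have "real n ^ 1 \<le> real n ^ Suc k"
      using \<open>n \<ge> 2\<close> by (intro power_increasing) auto
    moreover have "real_of_int d < real n" using \<open>d < int n\<close> by linarith
    ultimately have "real_of_int d < real n ^ Suc k" by simp
    then have "0 \<le> of_int d / real n ^ Suc k" "of_int d / real n ^ Suc k < 1"
      using \<open>2 \<le> d\<close> \<open>n \<ge> 2\<close> by (auto simp del: power_Suc)
    \<comment> \<open>Tails in [0,1] contribute at most 1 in absolute value and the added term less
      than 1; the strict bound 2 is exactly what the digit gap excludes.\<close>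
    with eq bounds have "\<bar>real_of_int (x 0) - of_int (t 0)\<bar> < 2" by linarith
    then have "\<bar>x 0 - t 0\<bar> < 2" by linarith
    then have "x 0 = t 0"
      using sparse_digits_gap[OF sparse Suc.prems(1)[of 0] Suc.prems(2)[of 0]] by linarith
    with eq Suc.IH[of "\<lambda>k. x (Suc k)" "\<lambda>k. t (Suc k)"] Suc.prems show False by simp
  qed
qed

text \<open>The point t = 0 + t lies in both C and C + t, and nothing in C + t is smaller because C
  is nonnegative. Subtracting this minimum removes the shift.\<close>

lemma normalized_intersection_of_element:
  assumes "0 \<in> digit_cantor_set n D" "t \<in> digit_cantor_set n D"
    and "\<And>y. y \<in> digit_cantor_set n D \<Longrightarrow> 0 \<le> y"
  shows "normalized_intersection n D t
    = {y \<in> digit_cantor_set n D. y + t \<in> digit_cantor_set n D}"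
proof -
  have t: "t \<in> self_intersection n D t"
    using assms(1,2) unfolding self_intersection_def by force
  moreover have "t \<le> v" if "v \<in> self_intersection n D t" for v
    using that assms(3) unfolding self_intersection_def by auto
  ultimately have "Inf (self_intersection n D t) = t"
    by (rule cInf_eq_minimum)
  with t have "normalized_intersection n D t = (\<lambda>x. x - t) ` self_intersection n D t"
    unfolding normalized_intersection_def by auto
  also have "\<dots> = {y \<in> digit_cantor_set n D. y + t \<in> digit_cantor_set n D}"
    unfolding self_intersection_def by (force intro: rev_image_eqI)
  finally show ?thesis .
qed

text \<open>An enumeration of all sets of naturals would be a surjection from the naturals onto
  their power set.\<close>

lemma uncountable_UNIV_nat_set: "uncountable (UNIV :: nat set set)"
proof
  assume "countable (UNIV :: nat set set)"
  then have "range (from_nat_into (UNIV :: nat set set)) = Pow UNIV"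
    by simp
  then show False using Cantors_theorem[of UNIV] by blast
qed

theorem proposition5p1:
  fixes n :: nat and D :: "int set"
  assumes "n \<ge> 3"
    and "D \<subseteq> {0..int n - 1}"
    and "2 \<le> card D" and "card D < n"
    and "Min D = 0"
    and "sparse_digits D"
    and "Max D < int n"
  shows "\<exists>\<Gamma> \<subseteq> nonneg_intersecting_translations n D. uncountable \<Gamma> \<and>
           (\<forall>\<gamma>\<in>\<Gamma>. \<forall>q\<in>\<rat>. \<not> translation_equivalent n D \<gamma> q)"
proof -
  define d where "d = Max D"
  define t where "t A = expansion n (\<lambda>k. if k \<in> A then d else 0)" for A
  let ?C = "digit_cantor_set n D" and ?N = "normalized_intersection n D"
  have n2: "n \<ge> 2" and fin: "finite D" and ne: "D \<noteq> {}"
    using assms(1-3) by (auto intro: finite_subset)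
  have "0 \<in> D" using Min_in[OF fin ne] assms(5) by simp
  have "d \<in> D" using Max_in[OF fin ne] by (simp add: d_def)
  have Dd: "D \<subseteq> {0..d}" using assms(2) fin by (auto simp: d_def)
  have "d < int n" using assms(7) by (simp add: d_def)
  have "d \<noteq> 0"
  proof
    assume "d = 0"
    then have "card D \<le> card {0::int}" using Dd by (intro card_mono) auto
    with assms(3) show False by simp
  qed
  \<comment> \<open>The distinct digits d and 0 must themselves be at least 2 apart.\<close>
  then have "2 \<le> d"
    using sparse_digits_gap[OF assms(6) \<open>d \<in> D\<close> \<open>0 \<in> D\<close>] Dd \<open>d \<in> D\<close> by force
  have C_nonneg: "0 \<le> y" if "y \<in> ?C" for y
    using that assms(2) expansion_nonneg[OF n2] unfolding digit_cantor_set_eq_expansion by blast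
  have tC: "t A \<in> ?C" for A
    unfolding digit_cantor_set_eq_expansion t_def using \<open>0 \<in> D\<close> \<open>d \<in> D\<close> by auto
  have t_insert: "t (insert k A) = t A + of_int d / real n ^ Suc k" if "k \<notin> A" for k A
  proof -
    have "(\<lambda>j. if j \<in> insert k A then d else 0) = (\<lambda>j. if j \<in> A then d else 0)(k := d)"
      by auto
    then show ?thesis
      using expansion_add_digit[OF n2, of "\<lambda>j. if j \<in> A then d else 0" k d] that
        \<open>2 \<le> d\<close> \<open>d < int n\<close> by (simp add: t_def)
  qed
  \<comment> \<open>This puts 0 in C and, through \<open>t_insert\<close>, identifies d/n^(k+1) with
    \<open>t {k}\<close>.\<close>
  have t_empty: "t {} = 0" by (simp add: t_def expansion_def)
  have N_t: "?N (t A) = {y \<in> ?C. y + t A \<in> ?C}" for A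
    using tC[of "{}"] tC C_nonneg by (intro normalized_intersection_of_element) (auto simp: t_empty)
  have recover: "of_int d / real n ^ Suc k \<in> ?N (t A) \<longleftrightarrow> k \<notin> A" for k A
  proof
    \<comment> \<open>The point is \<open>t {k}\<close>, and its translate by \<open>t A\<close> is
      \<open>t (insert k A)\<close>; both lie in C.\<close>
    assume "k \<notin> A"
    then show "of_int d / real n ^ Suc k \<in> ?N (t A)"
      using tC[of "{k}"] tC[of "insert k A"] t_insert[of k A] t_insert[of k "{}"]
      by (simp add: N_t t_empty add.commute)
  next
    assume "of_int d / real n ^ Suc k \<in> ?N (t A)"
    then obtain x where "t A + of_int d / real n ^ Suc k = expansion n x" "\<forall>j. x j \<in> D"
      unfolding N_t digit_cantor_set_eq_expansion by (auto simp: add.commute)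
    moreover have "expansion n x \<noteq> t A + of_int d / real n ^ Suc k" if "k \<in> A" "\<forall>j. x j \<in> D"
      unfolding t_def
      using that \<open>0 \<in> D\<close> \<open>d \<in> D\<close>
      by (intro expansion_neq_add_max_digit[OF n2 Dd \<open>d \<in> D\<close> \<open>2 \<le> d\<close> \<open>d < int n\<close> assms(6)]) auto
    ultimately show "k \<notin> A" by metis
  qed
  have "inj (\<lambda>A. ?N (t A))"
  proof (rule injI)
    fix A B assume "?N (t A) = ?N (t B)"
    then show "A = B" using recover by blast
  qed
  then have "uncountable (range (\<lambda>A. ?N (t A)))"
    using uncountable_UNIV_nat_set countable_image_inj_on by blast
  then have unc: "uncountable (range (\<lambda>A. ?N (t A)) - ?N ` \<rat>)"
    by (intro uncountable_minus_countable countable_image countable_rat)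
  \<comment> \<open>Rational translations yield only countably many normalized sets. Keeping the
    \<open>t A\<close> whose set is none of these leaves uncountably many sets, hence uncountably
    many translations.\<close>
  define \<Gamma> where "\<Gamma> = {\<gamma> \<in> range t. ?N \<gamma> \<notin> ?N ` \<rat>}"
  have "range (\<lambda>A. ?N (t A)) - ?N ` \<rat> \<subseteq> ?N ` \<Gamma>"
    unfolding \<Gamma>_def by auto
  with unc have "uncountable (?N ` \<Gamma>)"
    by (metis countable_subset)
  then have "uncountable \<Gamma>"
    by (metis countable_image)
  moreover have "t A \<in> nonneg_intersecting_translations n D" for A
  proof -
    have "t A \<in> self_intersection n D (t A)"
      using tC[of A] tC[of "{}"] unfolding self_intersection_def by (force simp: t_empty)
    then show ?thesis
      using C_nonneg[OF tC[of A]]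
      unfolding nonneg_intersecting_translations_def intersecting_translations_def by auto
  qed
  then have "\<Gamma> \<subseteq> nonneg_intersecting_translations n D"
    unfolding \<Gamma>_def by auto
  moreover have "\<forall>\<gamma>\<in>\<Gamma>. \<forall>q\<in>\<rat>. \<not> translation_equivalent n D \<gamma> q"
    unfolding \<Gamma>_def translation_equivalent_def by auto
  ultimately show ?thesis by blast
qed

end
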